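(* For every $n \geq 0$, the number of upper zigzag paths in $P(n,n)$ equals the odd-indexed Fibonacci number $f_{2n+1}$.
   Context: The Fibonacci sequence is defined by $f_0 = 0$, $f_1 = 1$, $f_{n+2} = f_{n+1} + f_n$. $P(n,n)$ denotes the set of words $w \in \{x,y\}^{*}$ with exactly $n$ occurrences of $x$ and $n$ occurrences of $y$, identified with lattice paths from $(0,0)$ to $(n,n)$ where $x$ is a unit East step and $y$ is a unit North step. If $w = w_0 w_1$ where $w_0$ ends with $y$ and $w_1$ begins with $x$, then $w$ has a North-East turn at the point $(a,b)$, where $a$ and $b$ are the numbers of $x$'s and $y$'s in $w_0$; if $w_0$ ends with $x$ and $w_1$ begins with $y$, then $w$ has an East-North turn at the point $(a,b)$, defined in the same way. A path is an upper zigzag if each of its North-East turns is above the line $y = x + \frac12$ and each of its East-North turns is below this line; equivalently, every North-East turn $(a,b)$ satisfies $a < b$ and every East-North turn $(a,b)$ satisfies $b \leq a$. *)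

theory Defs
  imports Complex_Main "HOL-Number_Theory.Fib"
begin

text \<open>\<open>X\<close> is a unit East step, \<open>Y\<close> a unit North step; a word is read as a lattice path from \<open>(0,0)\<close>.\<close>

datatype step = X | Y

definition paths :: "nat \<Rightarrow> step list set" where
  "paths n = {w. count_list w X = n \<and> count_list w Y = n}"

definition NE_turn :: "step list \<Rightarrow> nat \<times> nat \<Rightarrow> bool" where
  "NE_turn w p \<longleftrightarrow> (\<exists>w0 w1. w = w0 @ w1 \<and> w0 \<noteq> [] \<and> w1 \<noteq> [] \<and> last w0 = Y \<and> hd w1 = X
     \<and> p = (count_list w0 X, count_list w0 Y))"

definition EN_turn :: "step list \<Rightarrow> nat \<times> nat \<Rightarrow> bool" where
  "EN_turn w p \<longleftrightarrow> (\<exists>w0 w1. w = w0 @ w1 \<and> w0 \<noteq> [] \<and> w1 \<noteq> [] \<and> last w0 = X \<and> hd w1 = Y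
     \<and> p = (count_list w0 X, count_list w0 Y))"

definition upper_zigzag :: "step list \<Rightarrow> bool" where
  "upper_zigzag w \<longleftrightarrow>
     (\<forall>a b. NE_turn w (a, b) \<longrightarrow> real b > real a + 1 / 2) \<and>
     (\<forall>a b. EN_turn w (a, b) \<longrightarrow> real b < real a + 1 / 2)"

lemma upper_zigzag_iff:
  "upper_zigzag w \<longleftrightarrow>
     (\<forall>a b. NE_turn w (a, b) \<longrightarrow> a < b) \<and> (\<forall>a b. EN_turn w (a, b) \<longrightarrow> b \<le> a)"
proof -
  have "real b > real a + 1 / 2 \<longleftrightarrow> a < b" "real b < real a + 1 / 2 \<longleftrightarrow> b \<le> a" for a b :: nat
    by linarith+
  then show ?thesis
    by (simp add: upper_zigzag_def)
qed

end

theory Submission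
  imports Defs
begin

text \<open>
  Let the turns of an upper zigzag have East-North abscissae \<open>a\<^sub>1, a\<^sub>2, \<dots>\<close> and North-East ordinates
  \<open>b\<^sub>1, b\<^sub>2, \<dots>\<close>.  The turn conditions say precisely that \<open>0 \<le> a\<^sub>1 < b\<^sub>1 \<le> a\<^sub>2 < b\<^sub>2 \<le> \<dots>\<close>, so the number
  of ways to complete a partial path depends only on the direction of its last step and on the larger
  of its two coordinates, up to a shift by one.  Reading a path step by step therefore turns the
  count into the Fibonacci recurrence.
\<close>

text \<open>
  Continuations of a path that has reached \<open>(a, b)\<close> with last step \<open>s\<close>.  The empty path counts as
  having last step \<open>X\<close>: the spurious East-North turn at \<open>(0, 0)\<close> this may create is a legal one.
\<close>

fun zigzag_from :: "step \<Rightarrow> nat \<Rightarrow> nat \<Rightarrow> step list \<Rightarrow> bool" where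
  "zigzag_from s a b [] \<longleftrightarrow> True"
| "zigzag_from s a b (X # w) \<longleftrightarrow> (s = Y \<longrightarrow> a < b) \<and> zigzag_from X (Suc a) b w"
| "zigzag_from s a b (Y # w) \<longleftrightarrow> (s = X \<longrightarrow> b \<le> a) \<and> zigzag_from Y a (Suc b) w"

lemma all_splits_Cons:
  "(\<forall>u v. x # xs = u @ v \<longrightarrow> P u v) \<longleftrightarrow> P [] (x # xs) \<and> (\<forall>u v. xs = u @ v \<longrightarrow> P (x # u) v)"
  by (auto simp: Cons_eq_append_conv)

text \<open>Links the stepwise check to the splits that define turns: the empty prefix gives the
  check at the current point, and every longer prefix passes to the tail. \<open>s # u\<close>
  supplies a last step even when \<open>u\<close> is empty.\<close>

lemma zigzag_from_iff:
  "zigzag_from s a b w \<longleftrightarrow>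
    (\<forall>u v. w = u @ v \<longrightarrow> v \<noteq> [] \<longrightarrow>
      (last (s # u) = Y \<longrightarrow> hd v = X \<longrightarrow> a + count_list u X < b + count_list u Y) \<and>
      (last (s # u) = X \<longrightarrow> hd v = Y \<longrightarrow> b + count_list u Y \<le> a + count_list u X))"
proof (induction s a b w rule: zigzag_from.induct)
  case (1 s a b)
  show ?case by simp
next
  case (2 s a b w)
  show ?case
    unfolding zigzag_from.simps 2 all_splits_Cons by simp
next
  case (3 s a b w)
  show ?case
    unfolding zigzag_from.simps 3 all_splits_Cons by simp
qed

lemma upper_zigzag_iff_zigzag_from: "upper_zigzag w \<longleftrightarrow> zigzag_from X 0 0 w"
proof
  assume "zigzag_from X 0 0 w"
  then show "upper_zigzag w"
    unfolding zigzag_from_iff upper_zigzag_iff NE_turn_def EN_turn_def by auto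
next
  assume w: "upper_zigzag w"
  have "count_list u X < count_list u Y"
    if "w = u @ v" "v \<noteq> []" "last (X # u) = Y" "hd v = X" for u v
  proof -
    from that have "NE_turn w (count_list u X, count_list u Y)"
      unfolding NE_turn_def by (intro exI[of _ u] exI[of _ v]) (auto split: if_splits)
    with w show ?thesis by (auto simp: upper_zigzag_iff)
  qed
  moreover have "count_list u Y \<le> count_list u X"
    if "w = u @ v" "v \<noteq> []" "last (X # u) = X" "hd v = Y" for u v
  \<comment> \<open>The empty prefix gives no turn of \<open>w\<close>, but its condition is just 0
    \<le> 0.\<close>
  proof (cases "u = []")
    case False
    with that have "EN_turn w (count_list u X, count_list u Y)"
      unfolding EN_turn_def by (intro exI[of _ u] exI[of _ v]) auto
    with w show ?thesis by (auto simp: upper_zigzag_iff)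
  qed simp
  ultimately show "zigzag_from X 0 0 w"
    unfolding zigzag_from_iff by simp
qed

definition continuations :: "step \<Rightarrow> nat \<Rightarrow> nat \<Rightarrow> nat \<Rightarrow> nat \<Rightarrow> step list set" where
  "continuations s a b p q =
    {w. count_list w X = p \<and> count_list w Y = q \<and> zigzag_from s a b w}"

lemma length_eq_count_steps: "length w = count_list w X + count_list w Y"
proof (induction w)
  case (Cons c w)
  then show ?case by (cases c) auto
qed simp

lemma finite_continuations: "finite (continuations s a b p q)"
proof (rule finite_subset)
  have "c \<in> {X, Y}" for c by (cases c) auto
  then show "continuations s a b p q \<subseteq> {w. set w \<subseteq> {X, Y} \<and> length w = p + q}"
    unfolding continuations_def using length_eq_count_steps by blast
qed (rule finite_lists_length_eq, simp)

lemma continuations_unfold: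
  "continuations s a b p q =
    (if p = 0 \<and> q = 0 then {[]} else {}) \<union>
    (if p > 0 \<and> (s = Y \<longrightarrow> a < b) then (#) X ` continuations X (Suc a) b (p - 1) q else {}) \<union>
    (if q > 0 \<and> (s = X \<longrightarrow> b \<le> a) then (#) Y ` continuations Y a (Suc b) p (q - 1) else {})"
proof (rule set_eqI)
  fix w
  show "w \<in> continuations s a b p q \<longleftrightarrow> w \<in>
    (if p = 0 \<and> q = 0 then {[]} else {}) \<union>
    (if p > 0 \<and> (s = Y \<longrightarrow> a < b) then (#) X ` continuations X (Suc a) b (p - 1) q else {}) \<union>
    (if q > 0 \<and> (s = X \<longrightarrow> b \<le> a) then (#) Y ` continuations Y a (Suc b) p (q - 1) else {})"
  proof (cases w)
    case Nil
    then show ?thesis by (auto simp: continuations_def)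
  next
    case (Cons c v)
    then show ?thesis by (cases c) (auto simp: continuations_def image_iff)
  qed
qed

lemma card_continuations_unfold:
  "card (continuations s a b p q) =
    (if p = 0 \<and> q = 0 then 1 else 0) +
    (if p > 0 \<and> (s = Y \<longrightarrow> a < b) then card (continuations X (Suc a) b (p - 1) q) else 0) +
    (if q > 0 \<and> (s = X \<longrightarrow> b \<le> a) then card (continuations Y a (Suc b) p (q - 1)) else 0)"
  by (subst continuations_unfold, subst card_Un_disjoint; (subst card_Un_disjoint)?)
    (auto simp: finite_continuations card_image)

text \<open>The assumption puts the endpoint on the diagonal, at (N, N) say, so
  \<open>min p q\<close> is N - max a b, and after a \<open>Y\<close> step
  \<open>min p (q + 1)\<close> is N - max a (b - 1). The case \<open>p = 0\<close> is separate
  because the single completion by \<open>Y\<close> steps would otherwise be counted as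
  \<open>fib 0\<close>.\<close>

lemma card_continuations:
  assumes "a + p = b + q"
  shows "card (continuations s a b p q) =
    (if s = X then fib (2 * min p q + 1) else if p = 0 then 1 else fib (2 * min p (q + 1)))"
  using assms
proof (induction "p + q" arbitrary: s a b p q rule: less_induct)
  case less
  have EX: "card (continuations X (Suc a) b (p - 1) q) = fib (2 * min (p - 1) q + 1)" if "p > 0"
    using less.hyps[of "p - 1" q "Suc a" b X] less.prems that by simp
  have EY: "card (continuations Y a (Suc b) p (q - 1)) = (if p = 0 then 1 else fib (2 * min p q))"
    if "q > 0"
    using less.hyps[of p "q - 1" a "Suc b" Y] less.prems that by simp
  \<comment> \<open>On this diagonal, a < b means q < p and b \<le> a means p \<le> q, so the
    position drops out.\<close>
  have unfold: "card (continuations s a b p q) =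
    (if p = 0 \<and> q = 0 then 1 else 0) +
    (if p > 0 \<and> (s = Y \<longrightarrow> q < p) then fib (2 * min (p - 1) q + 1) else 0) +
    (if q > 0 \<and> (s = X \<longrightarrow> p \<le> q) then if p = 0 then 1 else fib (2 * min p q) else 0)"
    unfolding card_continuations_unfold[of s a b p q] using EX EY less.prems by auto
  show ?case
  proof (cases p)
    case 0
    then show ?thesis
      unfolding unfold by (cases s) auto
  next
    case (Suc p')
    then show ?thesis
      \<comment> \<open>Both steps are possible in two cases: after \<open>X\<close> with p \<le> q,
        fib (2p - 1) + fib (2p) = fib (2p + 1); after \<open>Y\<close> with q < p, fib (2q + 1) +
        fib (2q) = fib (2q + 2), where q = 0 fits since \<open>fib 0 = 0\<close>. Otherwise the
        direction is forced.\<close>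
      unfolding unfold by (cases s; cases p q rule: linorder_cases) (auto simp: min_absorb1 min_absorb2)
  qed
qed

theorem mainTheorem3:
  fixes n :: nat
  shows "card {w \<in> paths n. upper_zigzag w} = fib (2 * n + 1)"
proof -
  have "{w \<in> paths n. upper_zigzag w} = continuations X 0 0 n n"
    by (auto simp: paths_def continuations_def upper_zigzag_iff_zigzag_from)
  then show ?thesis
    by (simp add: card_continuations)
qed

end
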